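(* Let $\mathbf u(t)$, $t\in[0,T]$, be the solution of the full-order Hamiltonian system $$\dot{\mathbf u}=\mathbf D\,\nabla_{\mathbf u}H(\mathbf u),\qquad \mathbf u(0)=\mathbf u_0,$$ where $\mathbf u(t)\in\mathbb R^n$ and $\mathbf D\in\mathbb R^{n\times n}$ is skew-symmetric. Let $\boldsymbol\Phi\in\mathbb R^{n\times r}$ be the $r$-dimensional POD basis matrix of the snapshots consisting of the states $\mathbf u(t)$ and the weighted gradients $\mu\nabla_{\mathbf u}H(\mathbf u(t))$, and let $\mathbf a(t)\in\mathbb R^r$ be the solution of the structure-preserving reduced-order model $$\dot{\mathbf a}=\mathbf D_r\,\nabla_{\mathbf a}H(\boldsymbol\Phi\mathbf a),\qquad \mathbf D_r=\boldsymbol\Phi^\top\mathbf D\,\boldsymbol\Phi,$$ with the initial condition $\mathbf a(0)=\boldsymbol\Phi^\top\mathbf u_0$. Then the POD approximation error satisfies $$\int_0^T\|\mathbf u(t)-\boldsymbol\Phi\mathbf a(t)\|^2\,dt\le C(T,\mu)\sum_{j=r+1}^{d}\lambda_j,$$ where $\lambda_j$ is the $j$-th leading eigenvalue of the snapshot covariance matrix associated with these snapshots, $d$ is the rank of that matrix, and $C(T,\mu)$ is a constant.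
   Context: $\|\cdot\|$ is the Euclidean 2-norm (and the induced norm for matrices), and $\langle\cdot,\cdot\rangle$ is the Euclidean inner product. $H$ is the Hamiltonian function of the spatially discretized system, $\nabla_{\mathbf u}H$ is its gradient, and $\nabla_{\mathbf a}H(\boldsymbol\Phi\mathbf a)=\boldsymbol\Phi^\top\nabla_{\mathbf u}H(\boldsymbol\Phi\mathbf a)$ is the gradient of $\mathbf a\mapsto H(\boldsymbol\Phi\mathbf a)$. The number $\mu$ is the weight given to the gradient of $H$ in the snapshots. The entire continuous trajectory on $[0,T]$ is assumed available, and the snapshot covariance matrix is $$\mathbf R=\int_0^T\mathbf u(t)\mathbf u(t)^\top dt+\mu^2\int_0^T\nabla_{\mathbf u}H(\mathbf u(t))\,\nabla_{\mathbf u}H(\mathbf u(t))^\top dt,$$ with nonzero eigenvalues $\lambda_1\ge\lambda_2\ge\dots\ge\lambda_d>0$. The columns of $\boldsymbol\Phi$ are orthonormal eigenvectors of $\mathbf R$ for its $r$ largest eigenvalues, so $\boldsymbol\Phi^\top\boldsymbol\Phi=I_r$. Only the error due to POD truncation is considered; spatial and temporal discretization errors are suppressed. The theorem statement writes the constant only as $C(T,\mu)$. The proof gives it as $C(T,\mu)=1+T\alpha(T)\left(C_2^2+C_3^2/\mu^2\right)$ with $\alpha(T)=2\int_0^T e^{2C_1(T-\tau)}\,d\tau$, $C_1=\mathcal M[\boldsymbol\Phi\boldsymbol\Phi^\top\mathbf D\boldsymbol\Phi\boldsymbol\Phi^\top\nabla_{\mathbf u}H]$, $C_2=\|\boldsymbol\Phi\boldsymbol\Phi^\top\mathbf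 D\boldsymbol\Phi\boldsymbol\Phi^\top\|\,\mathcal L[\nabla_{\mathbf u}H]$, and $C_3=\|\boldsymbol\Phi\boldsymbol\Phi^\top\mathbf D\|$. Here, for a mapping $F:\mathbb R^n\to\mathbb R^n$, the Lipschitz constant is $\mathcal L[F]=\sup_{\mathbf u\ne\mathbf v}\frac{\|F(\mathbf u)-F(\mathbf v)\|}{\|\mathbf u-\mathbf v\|}$ and the logarithmic Lipschitz constant is $\mathcal M[F]=\sup_{\mathbf u\ne\mathbf v}\frac{\langle\mathbf u-\mathbf v,\,F(\mathbf u)-F(\mathbf v)\rangle}{\|\mathbf u-\mathbf v\|^2}$. *)

theory Defs
  imports "HOL-Analysis.Analysis" "HOL-Library.Multiset"
begin

definition gradient :: "(real^'n \<Rightarrow> real) \<Rightarrow> real^'n \<Rightarrow> real^'n"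
  where "gradient f x = (THE g. GDERIV f x :> g)"

definition outer_product :: "real^'n \<Rightarrow> real^'n \<Rightarrow> real^'n^'n"
  where "outer_product x y = (\<chi> i j. x $ i * y $ j)"

text \<open>The trajectory is \<open>u\<close>, and \<open>g t\<close> is the gradient of the Hamiltonian at \<open>u t\<close>.\<close>

definition snapshot_covariance ::
    "real \<Rightarrow> real \<Rightarrow> (real \<Rightarrow> real^'n) \<Rightarrow> (real \<Rightarrow> real^'n) \<Rightarrow> real^'n^'n"
  where "snapshot_covariance T \<mu> u g =
    integral {0..T} (\<lambda>t. outer_product (u t) (u t)) +
    \<mu>\<^sup>2 *\<^sub>R integral {0..T} (\<lambda>t. outer_product (g t) (g t))"

text \<open>Eigenvalues are repeated according to the dimension of their eigenspace. For the symmetric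
  matrices considered here this agrees with the algebraic multiplicity, so there are \<open>CARD('n)\<close>
  eigenvalues in total, zero included.\<close>

definition eigenspace :: "real^'n^'n \<Rightarrow> real \<Rightarrow> (real^'n) set"
  where "eigenspace A l = {x. A *v x = l *\<^sub>R x}"

definition eigenvalues :: "real^'n^'n \<Rightarrow> real set"
  where "eigenvalues A = {l. \<exists>x. x \<noteq> 0 \<and> A *v x = l *\<^sub>R x}"

definition eigenvalue_mset :: "real^'n^'n \<Rightarrow> real multiset"
  where "eigenvalue_mset A = (\<Sum>l\<in>eigenvalues A. replicate_mset (dim (eigenspace A l)) l)"

text \<open>The \<open>j\<close>-th largest eigenvalue, counted from \<open>j = 1\<close>.\<close>

definition leading_eigenvalue :: "real^'n^'n \<Rightarrow> nat \<Rightarrow> real"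
  where "leading_eigenvalue A j = rev (sorted_list_of_multiset (eigenvalue_mset A)) ! (j - 1)"

text \<open>The index type of the columns carries no order, so the bijection \<open>p\<close> records which of the
  \<open>CARD('r)\<close> leading eigenvalues each column belongs to.\<close>

definition is_pod_basis :: "real^'n^'n \<Rightarrow> real^'r^'n \<Rightarrow> bool"
  where "is_pod_basis R \<Phi> \<longleftrightarrow>
    transpose \<Phi> ** \<Phi> = mat 1 \<and>
    (\<exists>p. bij_betw p UNIV {1..CARD('r)} \<and>
      (\<forall>k. R *v column k \<Phi> = leading_eigenvalue R (p k) *\<^sub>R column k \<Phi>))"

text \<open>The two suprema below are meaningful only if the quotients are bounded above, as they are
  when \<open>F\<close> is Lipschitz continuous.\<close>

definition lipschitz_constant :: "(real^'n \<Rightarrow> real^'n) \<Rightarrow> real"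
  where "lipschitz_constant F = Sup {norm (F u - F v) / norm (u - v) |u v. u \<noteq> v}"

definition log_lipschitz_constant :: "(real^'n \<Rightarrow> real^'n) \<Rightarrow> real"
  where "log_lipschitz_constant F =
    Sup {inner (u - v) (F u - F v) / (norm (u - v))\<^sup>2 |u v. u \<noteq> v}"

text \<open>The induced matrix 2-norm; \<^const>\<open>norm\<close> on matrices would be the Frobenius norm.\<close>

definition matrix_norm2 :: "real^'m^'n \<Rightarrow> real"
  where "matrix_norm2 A = onorm (\<lambda>x. A *v x)"

definition pod_error_constant ::
    "real^'n^'n \<Rightarrow> (real^'n \<Rightarrow> real) \<Rightarrow> real^'r^'n \<Rightarrow> real \<Rightarrow> real \<Rightarrow> real"
  where "pod_error_constant D H \<Phi> T \<mu> =
    (let P = \<Phi> ** transpose \<Phi>;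
         C1 = log_lipschitz_constant (\<lambda>v. (P ** D ** P) *v gradient H v);
         C2 = matrix_norm2 (P ** D ** P) * lipschitz_constant (gradient H);
         C3 = matrix_norm2 (P ** D);
         \<alpha> = 2 * integral {0..T} (\<lambda>\<tau>. exp (2 * C1 * (T - \<tau>)))
     in 1 + T * \<alpha> * (C2\<^sup>2 + C3\<^sup>2 / \<mu>\<^sup>2))"

end

theory Submission
  imports Defs
begin

text \<open>
  Let \<open>P = \<Phi> \<Phi>\<^sup>T\<close> and split the error orthogonally as \<open>u - \<Phi> a = \<rho> + \<theta>\<close> with \<open>\<rho> = u - P u\<close> and
  \<open>\<theta> = P u - \<Phi> a\<close>; let \<open>\<eta>\<close> be the projection error of the gradient along the trajectory.
  Expanding the quadratic form of \<open>R\<close> in an orthonormal eigenbasis by Parseval's identity gives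
  \<open>\<integral>\<parallel>\<rho>\<parallel>\<^sup>2 + \<mu>\<^sup>2 \<integral>\<parallel>\<eta>\<parallel>\<^sup>2 = \<Sum>\<^sub>j\<^sub>>\<^sub>r \<lambda>\<^sub>j\<close>. The component \<open>\<theta>\<close> starts at zero and
  satisfies \<open>\<theta> \<bullet> \<theta>' \<le> C\<^sub>1 \<parallel>\<theta>\<parallel>\<^sup>2 + (C\<^sub>2 \<parallel>\<rho>\<parallel> + C\<^sub>3 \<parallel>\<eta>\<parallel>) \<parallel>\<theta>\<parallel>\<close>, so Gronwall's argument applied to
  \<open>\<parallel>\<theta>\<parallel>\<close> and the Cauchy--Schwarz inequality bound \<open>\<parallel>\<theta>\<parallel>\<^sup>2\<close> uniformly on \<open>[0, T]\<close> by the same sum.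
\<close>

section \<open>Orthonormal eigenbases of self-adjoint maps\<close>

text \<open>Taken relative to a subspace \<open>S\<close> because the eigenbasis is built by
  induction over invariant subspaces.\<close>

definition orthonormal_basis :: "'a::euclidean_space set \<Rightarrow> 'a set \<Rightarrow> bool"
  where "orthonormal_basis S B \<longleftrightarrow>
    finite B \<and> span B = S \<and> (\<forall>x\<in>B. \<forall>y\<in>B. x \<bullet> y = (if x = y then 1 else 0))"

text \<open>The expression vanishes at \<open>s = 0\<close>, so it has a minimum there and its
  derivative \<open>2 * c\<close> must be zero.\<close>

lemma linear_coefficient_zero:
  fixes c d :: real
  assumes "\<And>s. 0 \<le> 2 * s * c + s\<^sup>2 * d"
  shows "c = 0"
proof (rule ccontr)
  assume c: "c \<noteq> 0"
  have d: "0 < \<bar>d\<bar> + 1" by simp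
  \<comment> \<open>This \<open>s\<close> has the sign opposite to \<open>c\<close>; the denominator
    is never zero and is large enough for the linear term to outweigh the quadratic one.\<close>
  define s where "s = - c / (\<bar>d\<bar> + 1)"
  have s: "s * (\<bar>d\<bar> + 1) = - c"
    using d by (simp add: s_def)
  have "s \<noteq> 0" using c d by (simp add: s_def)
  then have "0 < s\<^sup>2" by simp
  have "s * c = s * (- (s * (\<bar>d\<bar> + 1)))"
    using s by simp
  then have "s * c = - (s\<^sup>2 * (\<bar>d\<bar> + 1))"
    by (simp add: power2_eq_square algebra_simps)
  then have "2 * s * c + s\<^sup>2 * d = s\<^sup>2 * (d - 2 * \<bar>d\<bar> - 2)"
    by (simp add: algebra_simps)
  moreover have "d - 2 * \<bar>d\<bar> - 2 < 0" by simp
  ultimately have "2 * s * c + s\<^sup>2 * d < 0"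
    using \<open>0 < s\<^sup>2\<close> by (simp add: mult_pos_neg)
  with assms[of s] show False by simp
qed

text \<open>A maximizer of the Rayleigh quotient on the compact unit sphere of \<open>S\<close> is
  an eigenvector. Allowing any invariant subspace prepares the induction that builds an
  eigenbasis.\<close>

lemma self_adjoint_eigenvector_exists:
  fixes f :: "'a::euclidean_space \<Rightarrow> 'a"
  assumes "linear f" and self_adjoint: "\<And>x y. f x \<bullet> y = x \<bullet> f y"
    and S: "subspace S" "f ` S \<subseteq> S" "S \<noteq> {0}"
  obtains v m where "v \<in> S" "norm v = 1" "f v = m *\<^sub>R v"
proof -
  interpret f: linear f by fact
  obtain x where x: "x \<in> S" "x \<noteq> 0"
    using S subspace_0 by blast
  have "x /\<^sub>R norm x \<in> S \<inter> sphere 0 1"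
    using x S(1) by (simp add: subspace_scale)
  then have "S \<inter> sphere 0 1 \<noteq> {}" by blast
  moreover have "compact (S \<inter> sphere 0 1)"
    by (simp add: S(1) closed_Int_compact closed_subspace)
  moreover have "continuous_on (S \<inter> sphere 0 1) (\<lambda>x. f x \<bullet> x)"
    by (intro continuous_intros linear_continuous_on f.linear_axioms linear_conv_bounded_linear[THEN iffD1])
  ultimately obtain v where v: "v \<in> S \<inter> sphere 0 1"
    and max: "\<And>y. y \<in> S \<inter> sphere 0 1 \<Longrightarrow> f y \<bullet> y \<le> f v \<bullet> v"
    using continuous_attains_sup[of "S \<inter> sphere 0 1" "\<lambda>x. f x \<bullet> x"] by blast
  define m where "m = f v \<bullet> v"
  have vv: "v \<bullet> v = 1" using v by (simp add: norm_eq_1)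
  \<comment> \<open>Homogeneity carries the maximum from the sphere to all of
    \<open>S\<close>.\<close>
  have bound: "f y \<bullet> y \<le> m * (y \<bullet> y)" if "y \<in> S" for y
  proof (cases "y = 0")
    case False
    have "y /\<^sub>R norm y \<in> S \<inter> sphere 0 1"
      using that False S(1) by (simp add: subspace_scale)
    from max[OF this] have "(f y \<bullet> y) / (norm y)\<^sup>2 \<le> m"
      by (simp add: f.scaleR m_def power2_eq_square divide_simps)
    then show ?thesis
      using False by (simp add: divide_simps power2_norm_eq_inner)
  qed (simp add: f.zero)
  \<comment> \<open>The quadratic form \<open>m * (y \<bullet> y) - f y \<bullet> y\<close> is nonnegative on \<open>S\<close> and vanishes at \<open>v\<close>, so its
    derivative at \<open>v\<close> in the direction \<open>w\<close>, which is \<open>2 * (w \<bullet> w)\<close>, is zero.\<close>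
  define w where "w = m *\<^sub>R v - f v"
  have "w \<in> S"
    using v S unfolding w_def by (meson IntE image_subset_iff subspace_diff subspace_scale)
  have "0 \<le> 2 * s * (w \<bullet> w) + s\<^sup>2 * (m * (w \<bullet> w) - f w \<bullet> w)" for s
  proof -
    have "v + s *\<^sub>R w \<in> S"
      using v \<open>w \<in> S\<close> S(1) by (simp add: subspace_add subspace_scale)
    from bound[OF this]
    have "f (v + s *\<^sub>R w) \<bullet> (v + s *\<^sub>R w) \<le> m * ((v + s *\<^sub>R w) \<bullet> (v + s *\<^sub>R w))" .
    also have "m * ((v + s *\<^sub>R w) \<bullet> (v + s *\<^sub>R w)) = m + 2 * s * (m * (v \<bullet> w)) + s\<^sup>2 * (m * (w \<bullet> w))"
      by (simp add: inner_add_left inner_add_right vv inner_commute[of w v] power2_eq_square algebra_simps)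
    also have "f (v + s *\<^sub>R w) \<bullet> (v + s *\<^sub>R w) = m + 2 * s * (f v \<bullet> w) + s\<^sup>2 * (f w \<bullet> w)"
      using self_adjoint[of w v]
      by (simp add: f.add f.scaleR inner_add_left inner_add_right m_def inner_commute[of w "f v"]
          power2_eq_square algebra_simps)
    finally have "2 * s * (f v \<bullet> w) + s\<^sup>2 * (f w \<bullet> w) \<le> 2 * s * (m * (v \<bullet> w)) + s\<^sup>2 * (m * (w \<bullet> w))"
      by simp
    moreover have "2 * s * (w \<bullet> w) = 2 * s * (m * (v \<bullet> w)) - 2 * s * (f v \<bullet> w)"
      by (subst (1) w_def) (simp add: inner_diff_left algebra_simps)
    ultimately show ?thesis
      unfolding right_diff_distrib by linarith
  qed
  then have "w \<bullet> w = 0" by (rule linear_coefficient_zero)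
  then have "f v = m *\<^sub>R v" by (simp add: w_def)
  then show thesis using v by (intro that[of v m]) auto
qed

text \<open>Induction on the dimension: split off a unit eigenvector \<open>v\<close>;
  self-adjointness makes its orthogonal complement in \<open>S\<close> invariant again.\<close>

lemma self_adjoint_orthonormal_eigenbasis:
  fixes f :: "'a::euclidean_space \<Rightarrow> 'a"
  assumes "linear f" and "\<And>x y. f x \<bullet> y = x \<bullet> f y"
    and "subspace S" "f ` S \<subseteq> S"
  shows "\<exists>B. orthonormal_basis S B \<and> (\<forall>b\<in>B. \<exists>m. f b = m *\<^sub>R b)"
  using assms(3,4)
proof (induction "dim S" arbitrary: S)
  case 0
  then have "S = {0}" by (metis dim_eq_0 subspace_0 subset_singletonD empty_iff)
  then show ?case by (intro exI[of _ "{}"]) (simp add: orthonormal_basis_def)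
next
  case (Suc d)
  then have "S \<noteq> {0}" by auto
  then obtain v m where v: "v \<in> S" "norm v = 1" "f v = m *\<^sub>R v"
    using self_adjoint_eigenvector_exists[OF assms(1,2) Suc.prems] by metis
  have vv: "v \<bullet> v = 1" using v(2) by (simp add: norm_eq_1)
  define S' where "S' = {y \<in> S. v \<bullet> y = 0}"
  have sub: "subspace S'"
    using Suc.prems(1) by (auto simp: S'_def subspace_def inner_add_right)
  have inv: "f ` S' \<subseteq> S'"
  proof clarify
    fix y assume y: "y \<in> S'"
    have "v \<bullet> f y = f v \<bullet> y" by (simp add: assms(2))
    also have "\<dots> = 0" using y v by (simp add: S'_def)
    finally show "f y \<in> S'" using y Suc.prems(2) by (auto simp: S'_def)
  qed
  have "S' = {y \<in> S. \<forall>x\<in>span {v}. orthogonal x y}"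
    by (auto simp: S'_def orthogonal_def span_singleton)
  then have "dim S' + dim (span {v}) = dim S"
    using dim_subspace_orthogonal_to_vectors[of "span {v}" S] Suc.prems(1) v(1)
    by (simp add: span_minimal)
  moreover have "dim (span {v}) = 1"
    using v(2) by (auto simp: dim_insert)
  ultimately have "d = dim S'" using Suc.hyps(2) by simp
  from Suc.hyps(1)[OF this sub inv] obtain B where B: "orthonormal_basis S' B"
    and eig: "\<forall>b\<in>B. \<exists>m. f b = m *\<^sub>R b" by blast
  have BS: "B \<subseteq> S'" using B span_superset by (auto simp: orthonormal_basis_def)
  have "span (insert v B) = S"
  proof
    show "span (insert v B) \<subseteq> S"
      using BS v(1) Suc.prems(1) by (intro span_minimal) (auto simp: S'_def)
    show "S \<subseteq> span (insert v B)"
    proof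
      fix x assume x: "x \<in> S"
      \<comment> \<open>Removing the component along \<open>v\<close> leaves a vector of the
        complement, which \<open>B\<close> spans.\<close>
      have "x - (v \<bullet> x) *\<^sub>R v \<in> S'"
        using x v(1) vv Suc.prems(1)
        by (simp add: S'_def subspace_diff subspace_scale inner_diff_right)
      then show "x \<in> span (insert v B)"
        using B by (auto simp: span_insert orthonormal_basis_def)
    qed
  qed
  then have "orthonormal_basis S (insert v B)"
    using B BS vv by (auto simp: orthonormal_basis_def S'_def inner_commute)
  then show ?case using eig v(3) by (intro exI[of _ "insert v B"]) auto
qed

section \<open>Expansions in an orthonormal basis\<close>

lemma orthonormal_basis_expansion:
  assumes "orthonormal_basis S B" "x \<in> S"
  shows "x = (\<Sum>b\<in>B. (b \<bullet> x) *\<^sub>R b)"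
proof -
  have B: "finite B" "span B = S" "\<And>x y. x \<in> B \<Longrightarrow> y \<in> B \<Longrightarrow> x \<bullet> y = (if x = y then 1 else 0)"
    using assms(1) by (auto simp: orthonormal_basis_def)
  obtain c where c: "x = (\<Sum>b\<in>B. c b *\<^sub>R b)"
    using assms(2) B by (auto simp: span_finite)
  have "b \<bullet> x = c b" if "b \<in> B" for b
  proof -
    have "b \<bullet> x = (\<Sum>a\<in>B. if a = b then c b else 0)"
      unfolding c inner_sum_right using B(3) that by (intro sum.cong) auto
    then show ?thesis using that B(1) by simp
  qed
  then show ?thesis using c by (metis (no_types, lifting) sum.cong)
qed

lemma orthonormal_basis_parseval:
  assumes "orthonormal_basis S B" "x \<in> S"
  shows "x \<bullet> x = (\<Sum>b\<in>B. (b \<bullet> x)\<^sup>2)"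
proof -
  have "x \<bullet> x = (\<Sum>b\<in>B. (b \<bullet> x) *\<^sub>R b) \<bullet> x"
    using orthonormal_basis_expansion[OF assms] by simp
  also have "\<dots> = (\<Sum>b\<in>B. (b \<bullet> x)\<^sup>2)"
    by (simp add: inner_sum_left power2_eq_square)
  finally show ?thesis .
qed

lemma orthonormal_basis_independent:
  assumes "orthonormal_basis S B"
  shows "independent B"
proof (rule pairwise_orthogonal_independent)
  show "pairwise orthogonal B"
    using assms by (simp add: orthonormal_basis_def pairwise_def orthogonal_def)
  show "0 \<notin> B"
    using assms by (force simp: orthonormal_basis_def)
qed

lemma dim_span_orthonormal_subset:
  assumes "orthonormal_basis S B" "C \<subseteq> B"
  shows "dim (span C) = card C"
  unfolding dim_span
  using independent_mono[OF orthonormal_basis_independent[OF assms(1)] assms(2)]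
  by (rule dim_eq_card_independent)

text \<open>The function \<open>l\<close> gives each basis vector its eigenvalue. Multiplicities,
  rank and ordered eigenvalues thereby become statements about the values of \<open>l\<close> on
  \<open>B\<close>.\<close>

locale orthonormal_eigenbasis =
  fixes A :: "real^'n^'n" and B :: "(real^'n) set" and l :: "real^'n \<Rightarrow> real"
  assumes basis: "orthonormal_basis UNIV B"
    and eigenvector: "b \<in> B \<Longrightarrow> A *v b = l b *\<^sub>R b"
begin

section \<open>Spectral data read off an eigenbasis\<close>

lemma finite_basis: "finite B"
  using basis by (simp add: orthonormal_basis_def)

lemma inner_basis: "x \<in> B \<Longrightarrow> y \<in> B \<Longrightarrow> x \<bullet> y = (if x = y then 1 else 0)"
  using basis by (simp add: orthonormal_basis_def)

lemma card_basis: "card B = CARD('n)"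
proof -
  have "dim (span B) = CARD('n)" using basis by (simp add: orthonormal_basis_def)
  then show ?thesis using dim_span_orthonormal_subset[OF basis order.refl] by simp
qed

lemma expansion: "x = (\<Sum>b\<in>B. (b \<bullet> x) *\<^sub>R b)"
  using orthonormal_basis_expansion[OF basis] by simp

lemma inner_image:
  assumes "b \<in> B"
  shows "b \<bullet> (A *v x) = l b * (b \<bullet> x)"
proof -
  have "A *v x = (\<Sum>a\<in>B. (a \<bullet> x) *\<^sub>R (A *v a))"
    by (subst expansion[of x]) (simp add: linear_sum[OF matrix_vector_mul_linear] o_def matrix_vector_mult_scaleR)
  then have "b \<bullet> (A *v x) = (\<Sum>a\<in>B. if a = b then l b * (b \<bullet> x) else 0)"
    using assms by (auto simp: inner_sum_right eigenvector inner_basis intro!: sum.cong)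
  then show ?thesis using assms finite_basis by simp
qed

text \<open>Coefficients in \<open>B\<close> are unique, so those outside \<open>C\<close> must
  vanish. This identifies both the eigenspaces and the range of \<open>A\<close>.\<close>

lemma mem_span_subset_iff:
  assumes "C \<subseteq> B"
  shows "x \<in> span C \<longleftrightarrow> (\<forall>b\<in>B - C. b \<bullet> x = 0)"
proof
  assume "x \<in> span C"
  then show "\<forall>b\<in>B - C. b \<bullet> x = 0"
    using assms by (induction rule: span_induct_alt) (auto simp: inner_add_right inner_basis)
next
  assume "\<forall>b\<in>B - C. b \<bullet> x = 0"
  then have "(\<Sum>b\<in>B. (b \<bullet> x) *\<^sub>R b) = (\<Sum>b\<in>C. (b \<bullet> x) *\<^sub>R b)"
    using assms finite_basis by (intro sum.mono_neutral_right) auto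
  also have "(\<Sum>b\<in>B. (b \<bullet> x) *\<^sub>R b) = x"
    by (rule expansion[symmetric])
  finally have "x = (\<Sum>b\<in>C. (b \<bullet> x) *\<^sub>R b)" .
  moreover have "(\<Sum>b\<in>C. (b \<bullet> x) *\<^sub>R b) \<in> span C"
    by (intro span_sum span_scale span_base)
  ultimately show "x \<in> span C" by (rule ssubst)
qed

text \<open>Tested against \<open>b\<close>, the eigenvalue equation reads
  \<open>l b * (b \<bullet> x) = m * (b \<bullet> x)\<close>, so only coefficients with
  \<open>l b = m\<close> can survive.\<close>

lemma eigenspace_eq_span: "eigenspace A m = span {b \<in> B. l b = m}"
proof (rule set_eqI)
  fix x
  have "y = z" if "\<forall>b\<in>B. b \<bullet> y = b \<bullet> z" for y z
    using expansion[of y] expansion[of z] that by (metis (no_types, lifting) sum.cong)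
  then have "x \<in> eigenspace A m \<longleftrightarrow> (\<forall>b\<in>B. b \<bullet> (A *v x) = b \<bullet> (m *\<^sub>R x))"
    unfolding eigenspace_def by auto
  also have "\<dots> \<longleftrightarrow> (\<forall>b\<in>B - {b \<in> B. l b = m}. b \<bullet> x = 0)"
    by (auto simp: inner_image)
  finally show "x \<in> eigenspace A m \<longleftrightarrow> x \<in> span {b \<in> B. l b = m}"
    by (subst mem_span_subset_iff) auto
qed

lemma dim_eigenspace: "dim (eigenspace A m) = card {b \<in> B. l b = m}"
  unfolding eigenspace_eq_span by (rule dim_span_orthonormal_subset[OF basis]) auto

lemma eigenvalues_eq: "eigenvalues A = l ` B"
proof -
  have "m \<in> eigenvalues A \<longleftrightarrow> \<not> eigenspace A m \<subseteq> {0}" for m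
    by (auto simp: eigenvalues_def eigenspace_def)
  also have "\<dots> m \<longleftrightarrow> dim (eigenspace A m) \<noteq> 0" for m
    by (simp add: dim_eq_0)
  also have "\<dots> m \<longleftrightarrow> m \<in> l ` B" for m
    using finite_basis by (auto simp: dim_eigenspace)
  finally show ?thesis by blast
qed

lemma eigenvalue_mset_eq: "eigenvalue_mset A = image_mset l (mset_set B)"
proof (rule multiset_eqI)
  fix m
  have "count (eigenvalue_mset A) m = (\<Sum>k\<in>l ` B. if k = m then card {b \<in> B. l b = m} else 0)"
    unfolding eigenvalue_mset_def eigenvalues_eq count_sum dim_eigenspace by (intro sum.cong) auto
  also have "\<dots> = card {b \<in> B. l b = m}"
    \<comment> \<open>If \<open>m\<close> is not a value of \<open>l\<close>, the sum is zero and
      the counted set is empty.\<close>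
    using finite_basis by (auto simp: card_eq_0_iff)
  also have "\<dots> = count (image_mset l (mset_set B)) m"
    unfolding count_conv_size_mset filter_mset_image_mset
    using finite_basis by (simp add: filter_mset_mset_set eq_commute)
  finally show "count (eigenvalue_mset A) m = count (image_mset l (mset_set B)) m" .
qed

text \<open>The map \<open>A\<close> kills the basis vectors with eigenvalue zero and rescales the
  others, which therefore span its range.\<close>

lemma rank_eq: "rank A = card {b \<in> B. l b \<noteq> 0}"
proof -
  have "range ((*v) A) = span {b \<in> B. l b \<noteq> 0}"
  proof
    show "range ((*v) A) \<subseteq> span {b \<in> B. l b \<noteq> 0}"
      by (auto simp: mem_span_subset_iff inner_image)
    have "b \<in> range ((*v) A)" if "b \<in> B" "l b \<noteq> 0" for b
      using that eigenvector by (intro range_eqI[of _ _ "(1 / l b) *\<^sub>R b"]) (simp add: matrix_vector_mult_scaleR)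
    then show "span {b \<in> B. l b \<noteq> 0} \<subseteq> range ((*v) A)"
      by (intro span_minimal) (auto intro: linear_subspace_image matrix_vector_mul_linear)
  qed
  then show ?thesis
    unfolding rank_dim_range by (simp add: dim_span_orthonormal_subset[OF basis] del: dim_span)
qed

lemma length_eigenvalue_list:
  "length (rev (sorted_list_of_multiset (eigenvalue_mset A))) = CARD('n)"
proof -
  have "size (mset (sorted_list_of_multiset (eigenvalue_mset A))) = card B"
    unfolding mset_sorted_list_of_multiset by (simp add: eigenvalue_mset_eq)
  then show ?thesis unfolding size_mset by (simp add: card_basis)
qed

text \<open>Summing over all positions of the sorted list forgets its order. Both sides are the
  trace of \<open>A\<close>.\<close>

lemma sum_leading_eigenvalue: "(\<Sum>j = 1..CARD('n). leading_eigenvalue A j) = sum l B"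
proof -
  let ?xs = "rev (sorted_list_of_multiset (eigenvalue_mset A))"
  have len: "length ?xs = CARD('n)"
    by (rule length_eigenvalue_list)
  have "(\<Sum>j = 1..CARD('n). leading_eigenvalue A j) = (\<Sum>i<CARD('n). ?xs ! i)"
    unfolding leading_eigenvalue_def
    by (rule sum.reindex_bij_witness[of _ Suc "\<lambda>j. j - 1"]) auto
  also have "\<dots> = sum_list ?xs"
    using len by (simp add: sum_list_sum_nth lessThan_atLeast0 del: length_rev)
  also have "\<dots> = sum_mset (eigenvalue_mset A)"
    by (metis mset_rev mset_sorted_list_of_multiset sum_mset_sum_list)
  also have "\<dots> = sum l B"
    by (simp add: eigenvalue_mset_eq sum_unfold_sum_mset)
  finally show ?thesis .
qed

text \<open>The list is decreasing and nonnegative, so a nonzero entry at place \<open>j\<close>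
  would make the first \<open>j\<close> entries all nonzero, more than \<open>rank A\<close>
  allows.\<close>

lemma leading_eigenvalue_beyond_rank:
  assumes nonneg: "\<And>b. b \<in> B \<Longrightarrow> 0 \<le> l b"
    and j: "rank A < j" "j \<le> CARD('n)"
  shows "leading_eigenvalue A j = 0"
proof (rule ccontr)
  let ?xs = "rev (sorted_list_of_multiset (eigenvalue_mset A))"
  assume "leading_eigenvalue A j \<noteq> 0"
  have len: "length ?xs = CARD('n)"
    by (rule length_eigenvalue_list)
  have mset: "mset ?xs = image_mset l (mset_set B)"
    by (simp add: eigenvalue_mset_eq)
  have "set ?xs = l ` B"
    using mset finite_basis by (metis finite_set_mset_mset_set set_image_mset set_mset_mset)
  then have pos: "0 < ?xs ! (j - 1)"
    using nonneg \<open>leading_eigenvalue A j \<noteq> 0\<close> j len nth_mem[of "j - 1" ?xs]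
    by (force simp: leading_eigenvalue_def)
  have "sorted_wrt (\<ge>) ?xs"
    by (simp add: sorted_wrt_rev)
  then have "?xs ! i \<noteq> 0" if "i < j" for i
    using sorted_wrt_nth_less[of "(\<ge>)" ?xs i "j - 1"] pos that j len by (cases "i = j - 1") force+
  then have "{..<j} \<subseteq> {i. i < length ?xs \<and> ?xs ! i \<noteq> 0}"
    using j len by auto
  then have "card {..<j} \<le> card {i. i < length ?xs \<and> ?xs ! i \<noteq> 0}"
    by (intro card_mono) auto
  then have "j \<le> length (filter (\<lambda>m. m \<noteq> 0) ?xs)"
    by (simp add: length_filter_conv_card)
  also have "\<dots> = size (filter_mset (\<lambda>m. m \<noteq> 0) (mset ?xs))"
    by (metis mset_filter size_mset)
  also have "\<dots> = rank A"
    unfolding mset rank_eq using finite_basis by (simp add: filter_mset_image_mset filter_mset_mset_set)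
  finally show False using j by simp
qed

end

section \<open>A Gronwall estimate\<close>

text \<open>The integral of \<open>(f x - s * g x)\<^sup>2\<close> is a quadratic polynomial in
  \<open>s\<close> that is never negative.\<close>

lemma integral_Cauchy_Schwarz:
  fixes f g :: "real \<Rightarrow> real"
  assumes "continuous_on {a..b} f" "continuous_on {a..b} g"
  shows "(integral {a..b} (\<lambda>x. f x * g x))\<^sup>2
    \<le> integral {a..b} (\<lambda>x. (f x)\<^sup>2) * integral {a..b} (\<lambda>x. (g x)\<^sup>2)"
proof -
  define A C B where "A = integral {a..b} (\<lambda>x. (f x)\<^sup>2)"
    and "C = integral {a..b} (\<lambda>x. f x * g x)" and "B = integral {a..b} (\<lambda>x. (g x)\<^sup>2)"
  have int: "(\<lambda>x. (f x)\<^sup>2) integrable_on {a..b}" "(\<lambda>x. f x * g x) integrable_on {a..b}"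
    "(\<lambda>x. (g x)\<^sup>2) integrable_on {a..b}"
    using assms by (auto intro!: integrable_continuous_interval continuous_intros)
  have quadratic: "0 \<le> A - 2 * s * C + s\<^sup>2 * B" for s
  proof -
    have "((\<lambda>x. (f x)\<^sup>2 - 2 * s * (f x * g x) + s\<^sup>2 * (g x)\<^sup>2) has_integral A - 2 * s * C + s\<^sup>2 * B) {a..b}"
      unfolding A_def B_def C_def
      using int by (intro has_integral_add has_integral_diff has_integral_mult_right integrable_integral)
    moreover have "(f x)\<^sup>2 - 2 * s * (f x * g x) + s\<^sup>2 * (g x)\<^sup>2 = (f x - s * g x)\<^sup>2" for x
      by (simp add: power2_eq_square algebra_simps)
    ultimately show ?thesis
      by (auto intro: has_integral_nonneg)
  qed
  have "C\<^sup>2 \<le> A * B"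
  proof (cases "B = 0")
    case True
    have "C = 0"
    proof (rule ccontr)
      assume "C \<noteq> 0"
      then show False
        \<comment> \<open>With \<open>B = 0\<close> the polynomial is affine in \<open>s\<close>,
          and this choice gives it the value -1.\<close>
        using quadratic[of "(A + 1) / (2 * C)"] True by (simp add: field_simps)
    qed
    then show ?thesis using True by simp
  next
    case False
    moreover have "0 \<le> B" unfolding B_def by (intro integral_nonneg int) simp
    ultimately have "0 < B" by simp
    then show ?thesis
      \<comment> \<open>This is the minimizer of the polynomial.\<close>
      using quadratic[of "C / B"] by (simp add: field_simps power2_eq_square)
  qed
  then show ?thesis by (simp add: A_def B_def C_def)
qed

text \<open>Formally, the norm of \<open>\<theta>\<close> grows at rate at most \<open>c\<close>
  times itself plus \<open>f\<close>. An integrating factor turns this into a bound by the integral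
  of \<open>h\<close>, and Cauchy-Schwarz then separates the exponential from \<open>f\<close>. The
  sign of \<open>c\<close> is arbitrary.\<close>

lemma gronwall_norm_square:
  fixes \<theta> \<theta>' :: "real \<Rightarrow> 'a::real_inner" and f :: "real \<Rightarrow> real"
  assumes deriv: "\<And>t. t \<in> {0..T} \<Longrightarrow> (\<theta> has_vector_derivative \<theta>' t) (at t within {0..T})"
    and init: "\<theta> 0 = 0"
    and bound: "\<And>t. t \<in> {0..T} \<Longrightarrow> \<theta> t \<bullet> \<theta>' t \<le> c * (norm (\<theta> t))\<^sup>2 + f t * norm (\<theta> t)"
    and f: "continuous_on {0..T} f" "\<And>t. t \<in> {0..T} \<Longrightarrow> 0 \<le> f t"
    and t: "t \<in> {0..T}"
  shows "(norm (\<theta> t))\<^sup>2 \<le> integral {0..t} (\<lambda>\<tau>. exp (2 * c * (t - \<tau>))) * integral {0..t} (\<lambda>\<tau>. (f \<tau>)\<^sup>2)"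
proof -
  define h where "h s = exp (- c * s) * f s" for s
  define z where "z s = exp (- 2 * c * s) * (norm (\<theta> s))\<^sup>2" for s
  define z' where "z' s = exp (- 2 * c * s) * (2 * (\<theta> s \<bullet> \<theta>' s) - 2 * c * (norm (\<theta> s))\<^sup>2)" for s
  define G where "G s = integral {0..s} h" for s
  have sqrt_z: "sqrt (z s) = exp (- c * s) * norm (\<theta> s)" for s
  proof -
    have "z s = (exp (- c * s) * norm (\<theta> s))\<^sup>2"
      by (simp add: z_def power_mult_distrib flip: exp_double)
    then show ?thesis by simp
  qed
  have z_nonneg: "0 \<le> z s" for s
    by (simp add: z_def)
  have h_cont: "continuous_on {0..T} h"
    unfolding h_def using f(1) by (intro continuous_intros)
  have z_deriv: "(z has_real_derivative z' s) (at s within {0..T})" if "s \<in> {0..T}" for s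
    unfolding z_def z'_def power2_norm_eq_inner has_real_derivative_iff_has_vector_derivative
    using deriv[OF that, unfolded has_vector_derivative_def]
    by (auto intro!: derivative_eq_intros simp: has_vector_derivative_def inner_commute algebra_simps)
  \<comment> \<open>The integrating factor in \<open>z\<close> cancels the \<open>c\<close> term of
    the hypothesis.\<close>
  have z'_le: "z' s \<le> 2 * h s * sqrt (z s)" if "s \<in> {0..T}" for s
  proof -
    have "z' s \<le> exp (- 2 * c * s) * (2 * (f s * norm (\<theta> s)))"
      unfolding z'_def using bound[OF that] by (intro mult_left_mono) auto
    also have "\<dots> = 2 * h s * sqrt (z s)"
      unfolding sqrt_z h_def by (simp flip: exp_add)
    finally show ?thesis .
  qed
  have "sqrt (z t) \<le> G t"
  proof (rule field_le_epsilon)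
    fix e :: real assume e: "0 < e"
    \<comment> \<open>The shift by \<open>e\<^sup>2\<close> keeps the square root differentiable where \<open>\<theta>\<close> vanishes.\<close>
    define \<phi> where "\<phi> s = sqrt (z s + e\<^sup>2) - G s" for s
    have zpos: "0 < z s + e\<^sup>2" for s
      using z_nonneg[of s] e by (simp add: add_nonneg_pos)
    have \<phi>_deriv: "(\<phi> has_real_derivative z' s / (2 * sqrt (z s + e\<^sup>2)) - h s) (at s within {0..T})"
      if s: "s \<in> {0..T}" for s
      unfolding \<phi>_def G_def
      using zpos[of s] z_deriv[OF s] integral_has_real_derivative[OF h_cont s]
      by (auto intro!: derivative_eq_intros simp: field_simps)
    have "\<phi> t \<le> \<phi> 0"
    proof (rule DERIV_nonpos_imp_decreasing_open[of 0 t])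
      show "0 \<le> t" using t by simp
      have "continuous_on {0..T} \<phi>"
        using \<phi>_deriv by (rule DERIV_continuous_on)
      then show "continuous_on {0..t} \<phi>"
        using t by (auto elim: continuous_on_subset)
      fix s assume s: "0 < s" "s < t"
      then have sT: "s \<in> {0..T}" using t by auto
      have "z' s \<le> 2 * h s * sqrt (z s + e\<^sup>2)"
        using f(2)[OF sT]
        by (intro order_trans[OF z'_le[OF sT]] mult_left_mono) (auto simp: h_def)
      then have "z' s / (2 * sqrt (z s + e\<^sup>2)) - h s \<le> 0"
        using zpos[of s] by (simp add: divide_le_eq mult_ac)
      \<comment> \<open>The monotonicity criterion asks for two-sided derivatives, available at
        interior points.\<close>
      moreover have "at s within {0..T} = at s"
        using s t by (intro at_within_Icc_at) auto
      ultimately show "\<exists>y. (\<phi> has_real_derivative y) (at s) \<and> y \<le> 0"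
        using \<phi>_deriv[OF sT] by metis
    qed
    \<comment> \<open>The initial value \<open>\<phi> 0\<close> is exactly \<open>e\<close>, since
      \<open>\<theta> 0\<close> and \<open>G 0\<close> vanish.\<close>
    then have "sqrt (z t + e\<^sup>2) \<le> G t + e"
      using e by (simp add: \<phi>_def z_def G_def init)
    moreover have "sqrt (z t) \<le> sqrt (z t + e\<^sup>2)" by simp
    ultimately show "sqrt (z t) \<le> G t + e" by linarith
  qed
  then have "z t \<le> (G t)\<^sup>2"
    using z_nonneg[of t] by (metis real_sqrt_ge_zero power_mono real_sqrt_pow2)
  also have "(G t)\<^sup>2 \<le> integral {0..t} (\<lambda>s. (exp (- c * s))\<^sup>2) * integral {0..t} (\<lambda>s. (f s)\<^sup>2)"
    unfolding G_def h_def using f(1) t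
    by (intro integral_Cauchy_Schwarz continuous_intros) (auto elim: continuous_on_subset)
  \<comment> \<open>Multiplying by this factor undoes the integrating factor and produces the kernel
    \<open>exp (2 * c * (t - s))\<close>.\<close>
  finally have "exp (2 * c * t) * z t \<le> exp (2 * c * t) *
      (integral {0..t} (\<lambda>s. (exp (- c * s))\<^sup>2) * integral {0..t} (\<lambda>s. (f s)\<^sup>2))"
    by (intro mult_left_mono) auto
  also have "\<dots> = integral {0..t} (\<lambda>s. exp (2 * c * t) * (exp (- c * s))\<^sup>2) * integral {0..t} (\<lambda>s. (f s)\<^sup>2)"
    by simp
  also have "(\<lambda>s. exp (2 * c * t) * (exp (- c * s))\<^sup>2) = (\<lambda>s. exp (2 * c * (t - s)))"
    by (simp add: algebra_simps flip: exp_double exp_add)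
  also have "exp (2 * c * t) * z t = (norm (\<theta> t))\<^sup>2"
    by (simp add: z_def flip: exp_add mult.assoc)
  finally show ?thesis .
qed

section \<open>Gradients, Lipschitz constants and covariance matrices\<close>

lemma GDERIV_unique:
  assumes "GDERIV f x :> g" "GDERIV f x :> g'"
  shows "g = g'"
proof -
  have "(\<lambda>h. h \<bullet> g) = (\<lambda>h. h \<bullet> g')"
    using assms unfolding gderiv_def by (rule has_derivative_unique)
  then show ?thesis using vector_eq_ldot by metis
qed

lemma gradient_eqI: "GDERIV f x :> g \<Longrightarrow> gradient f x = g"
  unfolding gradient_def by (blast intro: GDERIV_unique)

text \<open>Riesz representation: the derivative is the inner product with the vector whose
  coordinates are its values on the basis. With uniqueness, the description in
  \<open>gradient\<close> therefore denotes.\<close>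

lemma gradient_GDERIV:
  fixes f :: "real^'n \<Rightarrow> real"
  assumes "f differentiable (at x)"
  shows "GDERIV f x :> gradient f x"
proof -
  obtain f' where f': "(f has_derivative f') (at x)"
    using assms unfolding differentiable_def by blast
  interpret f': linear f' by (rule has_derivative_linear[OF f'])
  have "f' h = h \<bullet> (\<Sum>i\<in>Basis. f' i *\<^sub>R i)" for h
  proof -
    have "f' h = (\<Sum>i\<in>Basis. (h \<bullet> i) *\<^sub>R f' i)"
      by (subst euclidean_representation[symmetric, of h]) (simp only: f'.sum f'.scaleR)
    then show ?thesis by (simp add: inner_sum_right mult_ac)
  qed
  then have "f' = (\<lambda>h. h \<bullet> (\<Sum>i\<in>Basis. f' i *\<^sub>R i))" by (rule ext)
  then have "GDERIV f x :> (\<Sum>i\<in>Basis. f' i *\<^sub>R i)"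
    unfolding gderiv_def using f' by simp
  then show ?thesis by (metis gradient_eqI)
qed

lemma inner_transpose_mult: "x \<bullet> (transpose M *v y) = (M *v x) \<bullet> y" for M :: "real^'m^'n"
  by (simp add: dot_lmul_matrix inner_commute[of x] inner_commute[of y])

text \<open>Chain rule, with \<open>M\<close> moved across the inner product. It computes the
  gradient of the reduced Hamiltonian.\<close>

lemma gradient_compose_matrix:
  fixes M :: "real^'m^'n"
  assumes "\<And>v. f differentiable (at v)"
  shows "gradient (\<lambda>b. f (M *v b)) b = transpose M *v gradient f (M *v b)"
proof (rule gradient_eqI)
  have "((\<lambda>b. f (M *v b)) has_derivative (\<lambda>h. (M *v h) \<bullet> gradient f (M *v b))) (at b)"
    using bounded_linear_imp_has_derivative[OF matrix_vector_mul_bounded_linear]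
      gradient_GDERIV[OF assms, of "M *v b", unfolded gderiv_def]
    by (rule has_derivative_compose)
  then show "GDERIV (\<lambda>b. f (M *v b)) b :> transpose M *v gradient f (M *v b)"
    unfolding gderiv_def by (simp only: inner_transpose_mult)
qed

section \<open>Estimates from operator norms and Lipschitz constants\<close>

lemma norm_matrix_vector_mult_le: "norm (M *v x) \<le> matrix_norm2 M * norm x"
  unfolding matrix_norm2_def by (intro onorm matrix_vector_mul_bounded_linear)

text \<open>Any Lipschitz bound \<open>L\<close> bounds the set of quotients above, so its real
  supremum is a genuine upper bound.\<close>

lemma norm_diff_le_lipschitz_constant:
  assumes "L-lipschitz_on UNIV F"
  shows "norm (F u - F v) \<le> lipschitz_constant F * norm (u - v)"
proof (cases "u = v")
  case False
  have "norm (F u - F v) / norm (u - v) \<le> lipschitz_constant F"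
    unfolding lipschitz_constant_def
  proof (rule cSup_upper)
    show "bdd_above {norm (F u - F v) / norm (u - v) |u v. u \<noteq> v}"
      using lipschitz_onD[OF assms] by (auto intro!: bdd_aboveI[of _ L] simp: dist_norm divide_le_eq)
  qed (use False in blast)
  then show ?thesis using False by (simp add: divide_le_eq)
qed simp

lemma lipschitz_constant_nonneg:
  fixes F :: "real^'n \<Rightarrow> real^'n"
  assumes "L-lipschitz_on UNIV F"
  shows "0 \<le> lipschitz_constant F"
proof -
  fix i :: 'n
  have "0 \<le> norm (F (axis i 1) - F 0)" by simp
  also have "\<dots> \<le> lipschitz_constant F * norm (axis i 1 - 0 :: real^'n)"
    by (rule norm_diff_le_lipschitz_constant[OF assms])
  finally show ?thesis by simp
qed

text \<open>By Cauchy-Schwarz these quotients too are at most \<open>L\<close>. The resulting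
  constant may be negative.\<close>

lemma inner_diff_le_log_lipschitz_constant:
  assumes "L-lipschitz_on UNIV F"
  shows "(u - v) \<bullet> (F u - F v) \<le> log_lipschitz_constant F * (norm (u - v))\<^sup>2"
proof (cases "u = v")
  case False
  have "(u - v) \<bullet> (F u - F v) / (norm (u - v))\<^sup>2 \<le> log_lipschitz_constant F"
    unfolding log_lipschitz_constant_def
  proof (rule cSup_upper)
    have "(u - v) \<bullet> (F u - F v) / (norm (u - v))\<^sup>2 \<le> L" if "u \<noteq> v" for u v
    proof -
      have "(u - v) \<bullet> (F u - F v) \<le> norm (u - v) * norm (F u - F v)"
        by (rule norm_cauchy_schwarz)
      also have "\<dots> \<le> norm (u - v) * (L * norm (u - v))"
        using lipschitz_onD[OF assms, of u v] by (intro mult_left_mono) (auto simp: dist_norm)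
      finally show ?thesis using that by (simp add: divide_le_eq power2_eq_square mult_ac)
    qed
    then show "bdd_above {(u - v) \<bullet> (F u - F v) / (norm (u - v))\<^sup>2 |u v. u \<noteq> v}"
      by (auto intro!: bdd_aboveI[of _ L])
  qed (use False in blast)
  then show ?thesis using False by (simp add: divide_le_eq)
qed simp

section \<open>The bilinear form of the covariance matrix\<close>

lemma outer_product_mult: "outer_product v w *v y = (w \<bullet> y) *\<^sub>R v"
  by (simp add: vec_eq_iff outer_product_def inner_vec_def matrix_vector_mult_def sum_distrib_left mult_ac)

lemma continuous_on_outer_product:
  assumes "continuous_on S v" "continuous_on S w"
  shows "continuous_on S (\<lambda>t. outer_product (v t) (w t))"
  unfolding outer_product_def using assms by (intro continuous_intros continuous_on_vec_lambda)

text \<open>For fixed \<open>x\<close> and \<open>y\<close> the form is bounded linear in the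
  matrix, hence commutes with the integral.\<close>

lemma inner_integral_outer_product:
  fixes v :: "real \<Rightarrow> real^'n"
  assumes "continuous_on {a..b} v"
  shows "x \<bullet> (integral {a..b} (\<lambda>t. outer_product (v t) (v t)) *v y)
    = integral {a..b} (\<lambda>t. (x \<bullet> v t) * (v t \<bullet> y))"
proof -
  let ?h = "\<lambda>M. x \<bullet> (M *v y)"
  have "bounded_linear ?h"
    by (intro linear_conv_bounded_linear[THEN iffD1] linearI)
      (simp_all add: matrix_vector_mult_add_rdistrib inner_add_right scaleR_matrix_vector_assoc[symmetric])
  moreover have "(\<lambda>t. outer_product (v t) (v t)) integrable_on {a..b}"
    using assms by (intro integrable_continuous_real continuous_on_outer_product)
  ultimately have "integral {a..b} (?h \<circ> (\<lambda>t. outer_product (v t) (v t)))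
      = ?h (integral {a..b} (\<lambda>t. outer_product (v t) (v t)))"
    by (intro integral_linear)
  then show ?thesis by (simp add: o_def outer_product_mult mult.commute)
qed

lemma inner_snapshot_covariance:
  assumes "continuous_on {0..T} u" "continuous_on {0..T} g"
  shows "x \<bullet> (snapshot_covariance T \<mu> u g *v y) =
    integral {0..T} (\<lambda>t. (x \<bullet> u t) * (u t \<bullet> y)) + \<mu>\<^sup>2 * integral {0..T} (\<lambda>t. (x \<bullet> g t) * (g t \<bullet> y))"
  unfolding snapshot_covariance_def
  by (simp add: matrix_vector_mult_add_rdistrib inner_add_right scaleR_matrix_vector_assoc[symmetric]
      inner_integral_outer_product assms)

section \<open>The truncation error and its propagation\<close>

lemma integral_reflect_Icc:
  fixes h :: "real \<Rightarrow> real"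
  assumes "0 \<le> t" "continuous_on {0..t} h"
  shows "integral {0..t} (\<lambda>s. h (t - s)) = integral {0..t} h"
proof -
  have "((\<lambda>s. (- 1) *\<^sub>R h (t - s)) has_integral (integral {t - 0..t - t} h - integral {t - t..t - 0} h)) {0..t}"
    using assms
    by (intro has_integral_substitution_general[of "{}" 0 t "\<lambda>s. t - s" 0 t h "\<lambda>_. - 1"])
      (auto intro!: derivative_eq_intros continuous_intros)
  moreover have "integral {t..0} h = 0"
    using assms(1) by (cases "t = 0") auto
  ultimately have "((\<lambda>s. - h (t - s)) has_integral - integral {0..t} h) {0..t}"
    by simp
  from has_integral_neg[OF this] show ?thesis by (simp add: integral_unique)
qed

lemma integral_exp_reflect_mono:
  fixes c :: real
  assumes "0 \<le> s" "s \<le> t"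
  shows "integral {0..s} (\<lambda>\<tau>. exp (c * (s - \<tau>))) \<le> integral {0..t} (\<lambda>\<tau>. exp (c * (t - \<tau>)))"
proof -
  have "integral {0..s} (\<lambda>\<tau>. exp (c * (s - \<tau>))) = integral {0..s} (\<lambda>\<tau>. exp (c * \<tau>))"
    using assms by (intro integral_reflect_Icc) (auto intro!: continuous_intros)
  also have "\<dots> \<le> integral {0..t} (\<lambda>\<tau>. exp (c * \<tau>))"
    using assms by (intro integral_subset_le integrable_continuous_real continuous_intros) auto
  also have "\<dots> = integral {0..t} (\<lambda>\<tau>. exp (c * (t - \<tau>)))"
    using assms by (intro integral_reflect_Icc[symmetric]) (auto intro!: continuous_intros)
  finally show ?thesis .
qed

lemma norm_square_projection_error:
  fixes \<Phi> :: "real^'r^'n"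
  assumes "transpose \<Phi> ** \<Phi> = mat 1"
  shows "(norm (v - (\<Phi> ** transpose \<Phi>) *v v))\<^sup>2 = v \<bullet> v - (\<Sum>k\<in>UNIV. (column k \<Phi> \<bullet> v)\<^sup>2)"
proof -
  let ?w = "transpose \<Phi> *v v"
  have "(\<Phi> *v ?w) \<bullet> (\<Phi> *v ?w) = ?w \<bullet> (transpose \<Phi> *v (\<Phi> *v ?w))"
    by (rule inner_transpose_mult[symmetric])
  also have "transpose \<Phi> *v (\<Phi> *v ?w) = ?w"
    by (simp only: matrix_vector_mul_assoc matrix_mul_assoc assms matrix_mul_lid)
  finally have 1: "(\<Phi> *v ?w) \<bullet> (\<Phi> *v ?w) = ?w \<bullet> ?w" .
  have 2: "(\<Phi> *v ?w) \<bullet> v = ?w \<bullet> ?w"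
    by (rule inner_transpose_mult[symmetric])
  have "?w $ k = column k \<Phi> \<bullet> v" for k
    by (simp add: column_def matrix_vector_mult_def inner_vec_def transpose_def)
  then have 3: "?w \<bullet> ?w = (\<Sum>k\<in>UNIV. (column k \<Phi> \<bullet> v)\<^sup>2)"
    by (simp only: inner_vec_def inner_real_def power2_eq_square)
  have "(norm (v - \<Phi> *v ?w))\<^sup>2 = v \<bullet> v - 2 * ((\<Phi> *v ?w) \<bullet> v) + (\<Phi> *v ?w) \<bullet> (\<Phi> *v ?w)"
    unfolding power2_norm_eq_inner inner_diff_left inner_diff_right inner_commute[of v "\<Phi> *v ?w"] by simp
  then show ?thesis
    using 1 2 3 unfolding matrix_vector_mul_assoc by linarith
qed

lemma card_orthonormal_columns_le:
  fixes \<Phi> :: "real^'r^'n"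
  assumes "transpose \<Phi> ** \<Phi> = mat 1"
  shows "CARD('r) \<le> CARD('n)"
proof -
  have "inj ((*v) \<Phi>)"
    by (rule inj_on_inverseI[of _ "(*v) (transpose \<Phi>)"]) (simp only: matrix_vector_mul_assoc assms matrix_vector_mul_lid)
  then have "dim (range ((*v) \<Phi>)) = CARD('r)"
    by (subst dim_image_eq) auto
  then show ?thesis
    using dim_subset_UNIV[of "range ((*v) \<Phi>)"] by simp
qed

lemma pod_projection_error:
  fixes \<Phi> :: "real^'r^'n" and u g :: "real \<Rightarrow> real^'n"
  assumes cont: "continuous_on {0..T} u" "continuous_on {0..T} g"
    and R: "R = snapshot_covariance T \<mu> u g"
    and pod: "is_pod_basis R \<Phi>"
  shows "integral {0..T} (\<lambda>t. (norm (u t - (\<Phi> ** transpose \<Phi>) *v u t))\<^sup>2)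
      + \<mu>\<^sup>2 * integral {0..T} (\<lambda>t. (norm (g t - (\<Phi> ** transpose \<Phi>) *v g t))\<^sup>2)
    = (\<Sum>j = CARD('r) + 1..rank R. leading_eigenvalue R j)"
proof -
  define q where "q x = integral {0..T} (\<lambda>t. (x \<bullet> u t)\<^sup>2) + \<mu>\<^sup>2 * integral {0..T} (\<lambda>t. (x \<bullet> g t)\<^sup>2)" for x
  have quadratic_form: "x \<bullet> (R *v x) = q x" for x
    unfolding R inner_snapshot_covariance[OF cont] q_def
    by (simp add: power2_eq_square inner_commute)
  have self_adjoint: "(R *v x) \<bullet> y = x \<bullet> (R *v y)" for x y
    unfolding R inner_commute[of "_ *v x"] inner_snapshot_covariance[OF cont]
    by (simp add: inner_commute mult.commute)
  obtain B where B: "orthonormal_basis UNIV B" "\<forall>b\<in>B. \<exists>m. R *v b = m *\<^sub>R b"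
    using self_adjoint_orthonormal_eigenbasis[of "(*v) R" UNIV] self_adjoint by auto
  from bchoice[OF B(2)] obtain l where l: "\<And>b. b \<in> B \<Longrightarrow> R *v b = l b *\<^sub>R b" by blast
  interpret orthonormal_eigenbasis R B l
    using B(1) l by unfold_locales
  have q_basis: "q b = l b" if "b \<in> B" for b
    using quadratic_form[of b] inner_image[OF that, of b] inner_basis[OF that that] by simp
  have nonneg: "0 \<le> q x" for x
    unfolding q_def using cont
    by (intro add_nonneg_nonneg mult_nonneg_nonneg integral_nonneg integrable_continuous_real continuous_intros) auto

  obtain p where orth: "transpose \<Phi> ** \<Phi> = mat 1" and p: "bij_betw p UNIV {1..CARD('r)}"
    and eig: "\<And>k. R *v column k \<Phi> = leading_eigenvalue R (p k) *\<^sub>R column k \<Phi>"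
    using pod unfolding is_pod_basis_def by blast
  have unit: "column k \<Phi> \<bullet> column k \<Phi> = 1" for k
  proof -
    have "column k \<Phi> \<bullet> column k \<Phi> = (transpose \<Phi> ** \<Phi>) $ k $ k"
      by (simp add: column_def inner_vec_def transpose_def matrix_matrix_mult_def)
    then show ?thesis by (simp add: orth mat_def)
  qed
  have q_column: "q (column k \<Phi>) = leading_eigenvalue R (p k)" for k
    unfolding quadratic_form[symmetric] eig by (simp add: unit)
  have card_le: "CARD('r) \<le> CARD('n)"
    by (rule card_orthonormal_columns_le[OF orth])

  have error: "integral {0..T} (\<lambda>t. (norm (v t - (\<Phi> ** transpose \<Phi>) *v v t))\<^sup>2)
      = (\<Sum>b\<in>B. integral {0..T} (\<lambda>t. (b \<bullet> v t)\<^sup>2))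
        - (\<Sum>k\<in>UNIV. integral {0..T} (\<lambda>t. (column k \<Phi> \<bullet> v t)\<^sup>2))"
    if v: "continuous_on {0..T} v" for v :: "real \<Rightarrow> real^'n"
  proof (rule integral_unique)
    have int: "((\<lambda>t. (x \<bullet> v t)\<^sup>2) has_integral integral {0..T} (\<lambda>t. (x \<bullet> v t)\<^sup>2)) {0..T}" for x
      using v by (intro integrable_integral integrable_continuous_real continuous_intros)
    show "((\<lambda>t. (norm (v t - (\<Phi> ** transpose \<Phi>) *v v t))\<^sup>2) has_integral
        (\<Sum>b\<in>B. integral {0..T} (\<lambda>t. (b \<bullet> v t)\<^sup>2))
        - (\<Sum>k\<in>UNIV. integral {0..T} (\<lambda>t. (column k \<Phi> \<bullet> v t)\<^sup>2))) {0..T}"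
      unfolding norm_square_projection_error[OF orth] orthonormal_basis_parseval[OF B(1) UNIV_I]
      by (intro has_integral_diff has_integral_sum finite_basis finite int)
  qed
  have "integral {0..T} (\<lambda>t. (norm (u t - (\<Phi> ** transpose \<Phi>) *v u t))\<^sup>2)
      + \<mu>\<^sup>2 * integral {0..T} (\<lambda>t. (norm (g t - (\<Phi> ** transpose \<Phi>) *v g t))\<^sup>2)
    = (\<Sum>b\<in>B. q b) - (\<Sum>k\<in>UNIV. q (column k \<Phi>))"
    unfolding error[OF cont(1)] error[OF cont(2)] q_def
    by (simp add: sum.distrib sum_distrib_left right_diff_distrib)
  also have "(\<Sum>b\<in>B. q b) = (\<Sum>j = 1..CARD('n). leading_eigenvalue R j)"
    unfolding sum_leading_eigenvalue by (intro sum.cong q_basis refl)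
  also have "(\<Sum>k\<in>UNIV. q (column k \<Phi>)) = (\<Sum>j = 1..CARD('r). leading_eigenvalue R j)"
    unfolding q_column by (rule sum.reindex_bij_betw[OF p])
  also have "(\<Sum>j = 1..CARD('n). leading_eigenvalue R j) - (\<Sum>j = 1..CARD('r). leading_eigenvalue R j)
      = (\<Sum>j = CARD('r) + 1..CARD('n). leading_eigenvalue R j)"
    using sum.ub_add_nat[of 1 "CARD('r)" "leading_eigenvalue R" "CARD('n) - CARD('r)"] card_le by simp
  also have "\<dots> = (\<Sum>j = CARD('r) + 1..rank R. leading_eigenvalue R j)"
  proof (rule sum.mono_neutral_right)
    show "{CARD('r) + 1..rank R} \<subseteq> {CARD('r) + 1..CARD('n)}"
      using rank_bound[of R] by auto
    show "\<forall>j\<in>{CARD('r) + 1..CARD('n)} - {CARD('r) + 1..rank R}. leading_eigenvalue R j = 0"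
      using leading_eigenvalue_beyond_rank nonneg q_basis by (metis DiffE atLeastAtMost_iff not_le)
  qed simp
  finally show ?thesis .
qed

theorem theorem4p1:
  fixes H :: "real^'n \<Rightarrow> real"
    and D :: "real^'n^'n"
    and \<Phi> :: "real^'r^'n"
    and u :: "real \<Rightarrow> real^'n"
    and a :: "real \<Rightarrow> real^'r"
    and u0 :: "real^'n"
    and T \<mu> :: real
    and R :: "real^'n^'n"
  assumes T: "0 \<le> T"
    and mu: "\<mu> \<noteq> 0"
    and H_differentiable: "\<And>v. H differentiable (at v)"
    and gradient_lipschitz: "\<exists>L. L-lipschitz_on UNIV (gradient H)"
    and D_skew: "transpose D = - D"
    and full_order: "\<And>t. t \<in> {0..T} \<Longrightarrow>
          (u has_vector_derivative D *v gradient H (u t)) (at t within {0..T})"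
    and full_order_init: "u 0 = u0"
    and R_def: "R = snapshot_covariance T \<mu> u (\<lambda>t. gradient H (u t))"
    and pod: "is_pod_basis R \<Phi>"
    and reduced_order: "\<And>t. t \<in> {0..T} \<Longrightarrow>
          (a has_vector_derivative
             (transpose \<Phi> ** D ** \<Phi>) *v gradient (\<lambda>b. H (\<Phi> *v b)) (a t)) (at t within {0..T})"
    and reduced_order_init: "a 0 = transpose \<Phi> *v u0"
  shows "integral {0..T} (\<lambda>t. (norm (u t - \<Phi> *v a t))\<^sup>2)
    \<le> pod_error_constant D H \<Phi> T \<mu> * (\<Sum>j = CARD('r) + 1..rank R. leading_eigenvalue R j)"
proof -
  define P where "P = \<Phi> ** transpose \<Phi>"
  define F where "F v = (P ** D ** P) *v gradient H v" for v
  define C1 where "C1 = log_lipschitz_constant F"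
  define C2 where "C2 = matrix_norm2 (P ** D ** P) * lipschitz_constant (gradient H)"
  define C3 where "C3 = matrix_norm2 (P ** D)"
  define E where "E = integral {0..T} (\<lambda>\<tau>. exp (2 * C1 * (T - \<tau>)))"
  define g where "g t = gradient H (u t)" for t
  define \<rho> where "\<rho> t = u t - P *v u t" for t
  define \<eta> where "\<eta> t = g t - P *v g t" for t
  define \<theta> where "\<theta> t = P *v u t - \<Phi> *v a t" for t
  define \<theta>' where "\<theta>' t = (P ** D) *v g t - F (\<Phi> *v a t)" for t
  define f where "f t = C2 * norm (\<rho> t) + C3 * norm (\<eta> t)" for t
  define \<Lambda> where "\<Lambda> = (\<Sum>j = CARD('r) + 1..rank R. leading_eigenvalue R j)"
  define I1 I2 where "I1 = integral {0..T} (\<lambda>t. (norm (\<rho> t))\<^sup>2)" and "I2 = integral {0..T} (\<lambda>t. (norm (\<eta> t))\<^sup>2)"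

  obtain L where L: "L-lipschitz_on UNIV (gradient H)"
    using gradient_lipschitz by blast
  have matrix_norm2_nonneg: "0 \<le> matrix_norm2 M" for M :: "real^'n^'n"
    unfolding matrix_norm2_def by (rule onorm_pos_le[OF matrix_vector_mul_bounded_linear])
  have C2: "0 \<le> C2" and C3: "0 \<le> C3"
    unfolding C2_def C3_def using matrix_norm2_nonneg lipschitz_constant_nonneg[OF L] by simp_all
  have F_lipschitz: "(matrix_norm2 (P ** D ** P) * L)-lipschitz_on UNIV F"
  proof (rule lipschitz_onI)
    fix x y
    have "dist (F x) (F y) = norm ((P ** D ** P) *v (gradient H x - gradient H y))"
      by (simp add: F_def dist_norm matrix_vector_mult_diff_distrib)
    also have "\<dots> \<le> matrix_norm2 (P ** D ** P) * norm (gradient H x - gradient H y)"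
      by (rule norm_matrix_vector_mult_le)
    also have "\<dots> \<le> matrix_norm2 (P ** D ** P) * (L * dist x y)"
      using lipschitz_onD[OF L, of x y] by (intro mult_left_mono matrix_norm2_nonneg) (auto simp: dist_norm)
    finally show "dist (F x) (F y) \<le> matrix_norm2 (P ** D ** P) * L * dist x y"
      by (simp add: mult.assoc)
  qed (use matrix_norm2_nonneg lipschitz_on_nonneg[OF L] in simp)

  have orth: "transpose \<Phi> ** \<Phi> = mat 1"
    using pod by (simp add: is_pod_basis_def)
  have u_cont: "continuous_on {0..T} u"
    using full_order by (rule continuous_on_vector_derivative)
  have a_cont: "continuous_on {0..T} a"
    using reduced_order by (rule continuous_on_vector_derivative)
  have g_cont: "continuous_on {0..T} g"
    unfolding g_def using lipschitz_on_continuous_on[OF L] u_cont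
    by (rule continuous_on_compose2) auto
  note mult_cont = bounded_linear.continuous_on[OF matrix_vector_mul_bounded_linear]
  have \<rho>_cont: "continuous_on {0..T} \<rho>" and \<eta>_cont: "continuous_on {0..T} \<eta>"
    and \<theta>_cont: "continuous_on {0..T} \<theta>"
    unfolding \<rho>_def \<eta>_def \<theta>_def by (intro continuous_on_diff mult_cont u_cont g_cont a_cont)+
  have f_cont: "continuous_on {0..T} f"
    unfolding f_def by (intro continuous_intros \<rho>_cont \<eta>_cont)
  have f_nonneg: "0 \<le> f t" for t
    unfolding f_def using C2 C3 by simp

  have truncation: "I1 + \<mu>\<^sup>2 * I2 = \<Lambda>"
    unfolding I1_def I2_def \<Lambda>_def \<rho>_def \<eta>_def P_def
    using pod_projection_error[OF u_cont g_cont _ pod] R_def by (simp add: g_def[abs_def])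
  have int: "(\<lambda>t. (norm (\<rho> t))\<^sup>2) integrable_on {0..T}" "(\<lambda>t. (norm (\<eta> t))\<^sup>2) integrable_on {0..T}"
    "(\<lambda>t. (norm (\<theta> t))\<^sup>2) integrable_on {0..T}" "(\<lambda>t. (f t)\<^sup>2) integrable_on {0..T}"
    by (intro integrable_continuous_real continuous_intros \<rho>_cont \<eta>_cont \<theta>_cont f_cont)+
  have I1: "0 \<le> I1" and I2: "0 \<le> I2"
    unfolding I1_def I2_def by (intro integral_nonneg int; simp)+
  have I1_le: "I1 \<le> \<Lambda>"
    using truncation I2 by (smt (verit) mult_nonneg_nonneg zero_le_power2)
  have I2_le: "I2 \<le> \<Lambda> / \<mu>\<^sup>2"
    using truncation I1 mu by (simp add: pos_le_divide_eq mult.commute)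

  have \<theta>_deriv: "(\<theta> has_vector_derivative \<theta>' t) (at t within {0..T})" if "t \<in> {0..T}" for t
  proof -
    have "(\<theta> has_vector_derivative P *v (D *v g t) -
        \<Phi> *v ((transpose \<Phi> ** D ** \<Phi>) *v gradient (\<lambda>b. H (\<Phi> *v b)) (a t))) (at t within {0..T})"
      unfolding \<theta>_def g_def
      by (intro has_vector_derivative_diff full_order reduced_order that
          bounded_linear.has_vector_derivative[OF matrix_vector_mul_bounded_linear])
    also have "P *v (D *v g t) - \<Phi> *v ((transpose \<Phi> ** D ** \<Phi>) *v gradient (\<lambda>b. H (\<Phi> *v b)) (a t)) = \<theta>' t"
      unfolding gradient_compose_matrix[OF H_differentiable] \<theta>'_def F_def P_def
      by (simp only: matrix_vector_mul_assoc matrix_mul_assoc)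
    finally show ?thesis .
  qed
  have \<theta>_init: "\<theta> 0 = 0"
    unfolding \<theta>_def P_def full_order_init reduced_order_init by (simp only: matrix_vector_mul_assoc diff_self)
  have \<theta>_bound: "\<theta> t \<bullet> \<theta>' t \<le> C1 * (norm (\<theta> t))\<^sup>2 + f t * norm (\<theta> t)" for t
  proof -
    define w where "w = (P ** D) *v \<eta> t + (P ** D ** P) *v (g t - gradient H (P *v u t))"
    have "\<theta>' t = w + (F (P *v u t) - F (\<Phi> *v a t))"
      unfolding \<theta>'_def w_def \<eta>_def F_def
      by (simp only: matrix_vector_mult_diff_distrib matrix_vector_mul_assoc) simp
    then have "\<theta> t \<bullet> \<theta>' t = \<theta> t \<bullet> w + \<theta> t \<bullet> (F (P *v u t) - F (\<Phi> *v a t))"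
      by (simp add: inner_add_right)
    moreover have "\<theta> t \<bullet> (F (P *v u t) - F (\<Phi> *v a t)) \<le> C1 * (norm (\<theta> t))\<^sup>2"
      unfolding \<theta>_def C1_def by (rule inner_diff_le_log_lipschitz_constant[OF F_lipschitz])
    moreover have "\<theta> t \<bullet> w \<le> f t * norm (\<theta> t)"
    proof -
      have "norm w \<le> norm ((P ** D) *v \<eta> t) + norm ((P ** D ** P) *v (g t - gradient H (P *v u t)))"
        unfolding w_def by (rule norm_triangle_ineq)
      also have "\<dots> \<le> C3 * norm (\<eta> t) + matrix_norm2 (P ** D ** P) * norm (g t - gradient H (P *v u t))"
        unfolding C3_def by (intro add_mono norm_matrix_vector_mult_le)
      also have "\<dots> \<le> C3 * norm (\<eta> t) + matrix_norm2 (P ** D ** P) * (lipschitz_constant (gradient H) * norm (\<rho> t))"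
        unfolding g_def \<rho>_def
        by (intro add_left_mono mult_left_mono norm_diff_le_lipschitz_constant[OF L] matrix_norm2_nonneg)
      also have "\<dots> = f t" by (simp add: f_def C2_def)
      finally have "norm (\<theta> t) * norm w \<le> norm (\<theta> t) * f t"
        by (rule mult_left_mono) simp
      then show ?thesis
        using norm_cauchy_schwarz[of "\<theta> t" w] by (simp add: mult.commute)
    qed
    ultimately show ?thesis by linarith
  qed

  define K where "K = 2 * E * ((C2\<^sup>2 + C3\<^sup>2 / \<mu>\<^sup>2) * \<Lambda>)"
  have \<theta>_le: "(norm (\<theta> t))\<^sup>2 \<le> K" if t: "t \<in> {0..T}" for t
  proof -
    have "(norm (\<theta> t))\<^sup>2
        \<le> integral {0..t} (\<lambda>\<tau>. exp (2 * C1 * (t - \<tau>))) * integral {0..t} (\<lambda>\<tau>. (f \<tau>)\<^sup>2)"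
      by (rule gronwall_norm_square[OF \<theta>_deriv \<theta>_init \<theta>_bound f_cont f_nonneg t])
    also have "\<dots> \<le> E * (2 * ((C2\<^sup>2 + C3\<^sup>2 / \<mu>\<^sup>2) * \<Lambda>))"
    proof (rule mult_mono)
      show "integral {0..t} (\<lambda>\<tau>. exp (2 * C1 * (t - \<tau>))) \<le> E"
        unfolding E_def using t by (intro integral_exp_reflect_mono) auto
      have "integral {0..t} (\<lambda>\<tau>. (f \<tau>)\<^sup>2) \<le> integral {0..T} (\<lambda>\<tau>. (f \<tau>)\<^sup>2)"
        using t int(4) by (intro integral_subset_le integrable_subinterval_real[OF int(4)]) auto
      also have "\<dots> \<le> integral {0..T} (\<lambda>\<tau>. 2 * C2\<^sup>2 * (norm (\<rho> \<tau>))\<^sup>2 + 2 * C3\<^sup>2 * (norm (\<eta> \<tau>))\<^sup>2)"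
      proof (rule integral_le)
        fix \<tau>
        have "0 \<le> (C2 * norm (\<rho> \<tau>) - C3 * norm (\<eta> \<tau>))\<^sup>2" by simp
        then show "(f \<tau>)\<^sup>2 \<le> 2 * C2\<^sup>2 * (norm (\<rho> \<tau>))\<^sup>2 + 2 * C3\<^sup>2 * (norm (\<eta> \<tau>))\<^sup>2"
          unfolding f_def by (simp add: power2_sum power2_diff power_mult_distrib)
      qed (intro int integrable_add integrable_on_mult_right)+
      also have "\<dots> = 2 * C2\<^sup>2 * I1 + 2 * C3\<^sup>2 * I2"
        unfolding I1_def I2_def
        by (simp add: integral_add int integrable_on_mult_right)
      also have "\<dots> \<le> 2 * C2\<^sup>2 * \<Lambda> + 2 * C3\<^sup>2 * (\<Lambda> / \<mu>\<^sup>2)"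
        by (intro add_mono mult_left_mono I1_le I2_le) auto
      also have "\<dots> = 2 * ((C2\<^sup>2 + C3\<^sup>2 / \<mu>\<^sup>2) * \<Lambda>)"
        by (simp add: algebra_simps)
      finally show "integral {0..t} (\<lambda>\<tau>. (f \<tau>)\<^sup>2) \<le> 2 * ((C2\<^sup>2 + C3\<^sup>2 / \<mu>\<^sup>2) * \<Lambda>)" .
      show "0 \<le> E"
        unfolding E_def by (intro integral_nonneg integrable_continuous_real continuous_intros) auto
      show "0 \<le> integral {0..t} (\<lambda>\<tau>. (f \<tau>)\<^sup>2)"
        using t by (intro integral_nonneg integrable_subinterval_real[OF int(4)]) auto
    qed
    finally show ?thesis by (simp add: K_def mult_ac)
  qed

  have "(norm (u t - \<Phi> *v a t))\<^sup>2 = (norm (\<rho> t))\<^sup>2 + (norm (\<theta> t))\<^sup>2" for t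
  proof -
    have "transpose \<Phi> *v \<rho> t = 0"
      unfolding \<rho>_def P_def
      by (simp only: matrix_vector_mult_diff_distrib matrix_vector_mul_assoc matrix_mul_assoc orth matrix_mul_lid diff_self)
    moreover have "\<theta> t = \<Phi> *v (transpose \<Phi> *v u t - a t)"
      unfolding \<theta>_def P_def by (simp only: matrix_vector_mult_diff_distrib matrix_vector_mul_assoc)
    ultimately have "\<theta> t \<bullet> \<rho> t = 0"
      by (simp flip: inner_transpose_mult)
    moreover have "u t - \<Phi> *v a t = \<rho> t + \<theta> t"
      by (simp add: \<rho>_def \<theta>_def)
    ultimately show ?thesis
      unfolding power2_norm_eq_inner by (simp add: inner_add_left inner_add_right inner_commute)
  qed
  then have "integral {0..T} (\<lambda>t. (norm (u t - \<Phi> *v a t))\<^sup>2) = I1 + integral {0..T} (\<lambda>t. (norm (\<theta> t))\<^sup>2)"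
    unfolding I1_def by (simp add: integral_add int)
  also have "integral {0..T} (\<lambda>t. (norm (\<theta> t))\<^sup>2) \<le> integral {0..T} (\<lambda>t. K)"
    using \<theta>_le int(3) by (intro integral_le) auto
  also have "integral {0..T} (\<lambda>t. K) = T * K"
    using T by simp
  also have "I1 + T * K \<le> \<Lambda> + T * K"
    using I1_le by simp
  also have "\<dots> = pod_error_constant D H \<Phi> T \<mu> * \<Lambda>"
    unfolding pod_error_constant_def Let_def K_def E_def C1_def C2_def C3_def F_def[abs_def] P_def
    by (simp add: algebra_simps)
  finally show ?thesis by (simp add: \<Lambda>_def)
qed

end
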